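(* Let $n,k\ge 1$ and let ${\bf C}=(C_0,C_1,\dots,C_k)$ be a $(k+1)$-tuple of real $n\times n$ matrices having the $\mathbf{SSM}$-$W$ property. If $C_0$ is an $M$-matrix, then for every $q\in\mathbb{R}^n_+$ and every ${\bf d}\in(\mathbb{R}^n_{++})^{k-1}$, $\mathrm{EHLCP}({\bf C},{\bf d},q)$ has a unique solution.
   Context: Notation: $\mathbb{R}^n_{+}$ (resp. $\mathbb{R}^n_{++}$) is the set of vectors in $\mathbb{R}^n$ with all entries non-negative (resp. positive); $x\wedge y$ is the componentwise minimum and $x*y$ the Hadamard (componentwise) product of $x,y\in\mathbb{R}^n$; inequalities between vectors are componentwise. A real square matrix is a $Z$-matrix if all its off-diagonal entries are non-positive. A matrix $A\in\mathbb{R}^{n\times n}$ is an $M$-matrix if it is an invertible $Z$-matrix with $A^{-1}(\mathbb{R}^n_+)\subseteq\mathbb{R}^n_+$. Extended horizontal linear complementarity problem: given ${\bf C}=(C_0,\dots,C_k)$ with $C_i\in\mathbb{R}^{n\times n}$, $q\in\mathbb{R}^n$ and ${\bf d}=(d_1,\dots,d_{k-1})\in(\mathbb{R}^n_{++})^{k-1}$ (empty if $k=1$), $\mathrm{EHLCP}({\bf C},{\bf d},q)$ asks for $(x_0,x_1,\dots,x_k)\in(\mathbb{R}^n)^{k+1}$ with $$C_0x_0=q+\sum_{i=1}^k C_ix_i,\qquad x_0\wedge x_1=0,\qquad (d_j-x_j)\wedge x_{j+1}=0\ \ (1\le j\le k-1).$$ ${\bf C}$ has the $\mathbf{SSM}$-$W$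 property if, for all $x_0,x_1,\dots,x_k\in\mathbb{R}^n$, the conditions $C_0x_0=\sum_{i=1}^kC_ix_i$, $x_i\ge 0$ and $x_0*x_i\le 0$ for all $i\in\{1,\dots,k\}$ imply $x_0=x_1=\dots=x_k=0$. (No sign condition is imposed on $x_0$.) *)

theory Defs
  imports "HOL-Analysis.Analysis"
begin

text \<open>
  On \<open>real ^ 'n\<close> the library operations \<open>\<le>\<close>, \<open>inf\<close> and \<open>*\<close> are the componentwise order, the
  componentwise minimum and the Hadamard product. The strict order \<open><\<close> is \<^emph>\<open>not\<close> componentwise
  (it is \<open>\<le>\<close> and \<open>\<noteq>\<close>), so the positive orthant is spelled out in components.
\<close>

definition nonneg_orthant :: "(real ^ 'n) set" where
  "nonneg_orthant = {x. 0 \<le> x}"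

definition pos_orthant :: "(real ^ 'n) set" where
  "pos_orthant = {x. \<forall>i. 0 < x $ i}"

definition Z_matrix :: "real ^ 'n ^ 'n \<Rightarrow> bool" where
  "Z_matrix A \<longleftrightarrow> (\<forall>i j. i \<noteq> j \<longrightarrow> A $ i $ j \<le> 0)"

definition M_matrix :: "real ^ 'n ^ 'n \<Rightarrow> bool" where
  "M_matrix A \<longleftrightarrow> Z_matrix A \<and> invertible A \<and>
     (\<lambda>x. matrix_inv A *v x) ` nonneg_orthant \<subseteq> nonneg_orthant"

text \<open>
  Tuples indexed by \<open>0, \<dots>, k\<close> are functions on \<open>nat\<close>; values of \<open>C\<close> outside \<open>{0..k}\<close> and of \<open>d\<close>
  outside \<open>{1..<k}\<close> are never used.
\<close>

definition SSM_W :: "nat \<Rightarrow> (nat \<Rightarrow> real ^ 'n ^ 'n) \<Rightarrow> bool" where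
  "SSM_W k C \<longleftrightarrow>
     (\<forall>x :: nat \<Rightarrow> real ^ 'n.
        C 0 *v x 0 = (\<Sum>i = 1..k. C i *v x i) \<and>
        (\<forall>i \<in> {1..k}. 0 \<le> x i \<and> x 0 * x i \<le> 0)
        \<longrightarrow> (\<forall>i \<in> {0..k}. x i = 0))"

text \<open>
  Solutions are extensional functions (\<open>undefined\<close> outside \<open>{0..k}\<close>), so that equality of two
  solutions is equality of the tuples \<open>(x\<^sub>0, \<dots>, x\<^sub>k)\<close>.
\<close>

definition EHLCP ::
  "nat \<Rightarrow> (nat \<Rightarrow> real ^ 'n ^ 'n) \<Rightarrow> (nat \<Rightarrow> real ^ 'n) \<Rightarrow> real ^ 'n \<Rightarrow> (nat \<Rightarrow> real ^ 'n) set" where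
  "EHLCP k C d q =
     {x \<in> {0..k} \<rightarrow>\<^sub>E UNIV.
        C 0 *v x 0 = q + (\<Sum>i = 1..k. C i *v x i) \<and>
        inf (x 0) (x 1) = 0 \<and>
        (\<forall>j \<in> {1..<k}. inf (d j - x j) (x (j + 1)) = 0)}"

end

theory Submission
  imports Defs
begin

text \<open>
  Put \<open>p = C\<^sub>0\<^sup>-\<^sup>1 q\<close>, which is nonnegative because \<open>C\<^sub>0\<close> is an M-matrix; then \<open>(p, 0, \<dots>, 0)\<close> is a
  solution. Conversely, in any solution \<open>x\<close> the complementarity conditions chain: where \<open>x\<^sub>j\<^sub>+\<^sub>1\<close> is
  positive, \<open>x\<^sub>j\<close> equals \<open>d\<^sub>j > 0\<close>, hence \<open>x\<^sub>1\<close> is positive and \<open>x\<^sub>0\<close> vanishes. So \<open>x\<^sub>0 * x\<^sub>i = 0\<close>, and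
  the tuple \<open>(x\<^sub>0 - p, x\<^sub>1, \<dots>, x\<^sub>k)\<close> satisfies the hypotheses of the \<open>SSM\<close>-\<open>W\<close> property.
\<close>

lemma inf_vec_eq_0_iff:
  fixes x y :: "real ^ 'n"
  shows "inf x y = 0 \<longleftrightarrow> (\<forall>l. inf (x $ l) (y $ l) = 0)"
  by (simp add: vec_eq_iff inf_vec_def)

lemma M_matrix_solution_nonneg:
  assumes "M_matrix A" and "q \<in> nonneg_orthant"
  obtains p where "0 \<le> p" and "A *v p = q"
proof
  have "invertible A"
    using assms(1) by (simp add: M_matrix_def)
  then have "A ** matrix_inv A = mat 1"
    unfolding invertible_def matrix_inv_def by (rule someI2_ex) blast
  then show "A *v (matrix_inv A *v q) = q"
    by (simp add: matrix_vector_mul_assoc)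
  show "0 \<le> matrix_inv A *v q"
    using assms by (auto simp: M_matrix_def nonneg_orthant_def)
qed

lemma trivial_EHLCP_solution:
  fixes C :: "nat \<Rightarrow> real ^ 'n ^ 'n"
  assumes "k \<ge> 1" and "d \<in> {1..<k} \<rightarrow> pos_orthant" and "0 \<le> p" and "C 0 *v p = q"
  shows "(\<lambda>i\<in>{0..k}. if i = 0 then p else 0) \<in> EHLCP k C d q"
proof -
  have "(\<Sum>i = 1..k. C i *v (\<lambda>i\<in>{0..k}. if i = 0 then p else 0) i) = 0"
    by (intro sum.neutral) auto
  moreover have "inf p 0 = 0"
    using \<open>0 \<le> p\<close> by (simp add: inf_absorb2)
  \<comment> \<open>With \<open>x j = 0\<close> for \<open>j \<ge> 1\<close>, the slack
    \<open>d j - x j\<close> is \<open>d j\<close> itself.\<close>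
  moreover have "inf (d j) 0 = 0" if "j \<in> {1..<k}" for j
  proof -
    have "d j \<in> pos_orthant"
      using assms(2) that by blast
    then have "0 \<le> d j"
      by (simp add: pos_orthant_def less_eq_vec_def less_imp_le)
    then show ?thesis
      by (simp add: inf_absorb2)
  qed
  ultimately show ?thesis
    using assms(1,4) by (auto simp: EHLCP_def)
qed

text \<open>Each \<open>x i\<close> with \<open>i \<ge> 1\<close> is the second argument of a
  minimum equal to 0: paired with \<open>x 0\<close> if \<open>i = 1\<close>, otherwise with the
  slack of index \<open>i - 1\<close>.\<close>

lemma EHLCP_nonneg:
  assumes "x \<in> EHLCP k C d q" and "i \<in> {1..k}"
  shows "0 \<le> x i"
proof (cases "i = 1")
  case True
  have "inf (x 0) (x 1) = 0"
    using assms(1) by (simp add: EHLCP_def)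
  then show ?thesis
    using True by (metis inf.cobounded2)
next
  case False
  then have "i - 1 \<in> {1..<k}" and i: "i - 1 + 1 = i"
    using assms(2) by auto
  then have "inf (d (i - 1) - x (i - 1)) (x (i - 1 + 1)) = 0"
    using assms(1) unfolding EHLCP_def by blast
  then show ?thesis
    unfolding i by (metis inf.cobounded2)
qed

lemma EHLCP_complementary:
  fixes x :: "nat \<Rightarrow> real ^ 'n"
  assumes x: "x \<in> EHLCP k C d q" and d: "d \<in> {1..<k} \<rightarrow> pos_orthant" and i: "i \<in> {1..k}"
  shows "x 0 * x i = 0"
proof -
  have "x i $ l = 0" if l: "x 0 $ l \<noteq> 0" for l
  proof -
    have "1 \<le> i"
      using i by simp
    \<comment> \<open>Zeros at coordinate \<open>l\<close> propagate upwards from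
      \<open>x 1\<close>. The guard \<open>i \<le> k\<close> is part of the induction claim because
      \<open>x j\<close> and \<open>x (j + 1)\<close> are linked only for
      \<open>j < k\<close>.\<close>
    then have "i \<le> k \<longrightarrow> x i $ l = 0"
    proof (induction i rule: dec_induct)
      case base
      have "inf (x 0) (x 1) = 0"
        using x by (simp add: EHLCP_def)
      then have "inf (x 0 $ l) (x 1 $ l) = 0"
        by (simp add: inf_vec_eq_0_iff)
      with l show ?case
        by (auto simp: inf_real_def min_def split: if_splits)
    next
      case (step j)
      show ?case
      proof
        assume "Suc j \<le> k"
        then have j: "j \<in> {1..<k}" and "x j $ l = 0"
          using step by auto
        have "inf (d j - x j) (x (j + 1)) = 0"
          using x j unfolding EHLCP_def by blast
        then have "inf (d j $ l - x j $ l) (x (Suc j) $ l) = 0"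
          by (simp add: inf_vec_eq_0_iff)
        moreover have "0 < d j $ l"
          using d j by (auto simp: pos_orthant_def)
        ultimately show "x (Suc j) $ l = 0"
          using \<open>x j $ l = 0\<close> by (auto simp: inf_real_def min_def split: if_splits)
      qed
    qed
    then show ?thesis
      using i by simp
  qed
  then show ?thesis
    by (auto simp: vec_eq_iff)
qed

lemma EHLCP_solution_trivial:
  fixes C :: "nat \<Rightarrow> real ^ 'n ^ 'n"
  assumes "SSM_W k C" and d: "d \<in> {1..<k} \<rightarrow> pos_orthant" and "0 \<le> p" and p: "C 0 *v p = q"
    and x: "x \<in> EHLCP k C d q"
  shows "x = (\<lambda>i\<in>{0..k}. if i = 0 then p else 0)"
proof -
  \<comment> \<open>Subtracting \<open>p\<close> makes the equation homogeneous;
    \<open>SSM_W\<close> allows the entry at 0 to have any sign.\<close>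
  let ?y = "x(0 := x 0 - p)"
  have "C 0 *v ?y 0 = (\<Sum>i = 1..k. C i *v x i)"
    using x p by (simp add: EHLCP_def matrix_vector_mult_diff_distrib)
  also have "\<dots> = (\<Sum>i = 1..k. C i *v ?y i)"
    by (intro sum.cong) auto
  finally have "C 0 *v ?y 0 = (\<Sum>i = 1..k. C i *v ?y i)" .
  moreover have "0 \<le> ?y i \<and> ?y 0 * ?y i \<le> 0" if i: "i \<in> {1..k}" for i
  proof -
    have "0 \<le> x i"
      using x i by (rule EHLCP_nonneg)
    moreover have "(x 0 - p) * x i = - (p * x i)"
      using EHLCP_complementary[OF x d i] by (simp add: algebra_simps)
    moreover have "0 \<le> p * x i"
      using \<open>0 \<le> p\<close> \<open>0 \<le> x i\<close> by (simp add: less_eq_vec_def)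
    ultimately show ?thesis
      using i by (simp add: less_eq_vec_def)
  qed
  ultimately have y: "\<forall>i \<in> {0..k}. ?y i = 0"
    using assms(1) unfolding SSM_W_def by blast
  \<comment> \<open>\<open>y\<close> fixes \<open>x\<close> on \<open>{0..k}\<close> only;
    extensionality settles all other indices.\<close>
  have "x \<in> extensional {0..k}"
    using x by (simp add: EHLCP_def PiE_def)
  then show ?thesis
  proof (rule extensionalityI)
    show "x i = (\<lambda>i\<in>{0..k}. if i = 0 then p else 0) i" if "i \<in> {0..k}" for i
      using bspec[OF y that] that by (auto split: if_splits)
  qed auto
qed

theorem theorem4p10:
  fixes C :: "nat \<Rightarrow> real ^ 'n ^ 'n" and k :: nat
  assumes "k \<ge> 1"
    and "SSM_W k C"
    and "M_matrix (C 0)"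
  shows "\<forall>q \<in> nonneg_orthant. \<forall>d \<in> {1..<k} \<rightarrow> pos_orthant. \<exists>!x. x \<in> EHLCP k C d q"
proof (intro ballI)
  fix q :: "real ^ 'n" and d :: "nat \<Rightarrow> real ^ 'n"
  assume q: "q \<in> nonneg_orthant" and d: "d \<in> {1..<k} \<rightarrow> pos_orthant"
  obtain p where p: "0 \<le> p" "C 0 *v p = q"
    using M_matrix_solution_nonneg[OF assms(3) q] .
  show "\<exists>!x. x \<in> EHLCP k C d q"
    using trivial_EHLCP_solution[OF assms(1) d p(1), of C q, OF p(2)] EHLCP_solution_trivial[OF assms(2) d p(1), of q, OF p(2)]
    by (rule ex1I)
qed

end
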